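(* Let $R$ be an exchange ring which is a $CN$ ring. Then $R$ is strongly clean.
   Context: All rings are associative with identity, not necessarily commutative. $C(R)$ is the set of central elements of $R$ and $Nil(R)$ its set of nilpotent elements. A ring $R$ is called $CN$ if every $a\in R$ can be written as $a=c+n$ with $c\in C(R)$ and $n\in Nil(R)$. A ring $R$ is exchange if for each $a\in R$ there exists $e=e^2\in aR$ such that $1-e\in(1-a)R$. A ring is strongly clean if every element is the sum of an idempotent and a unit that commute with each other. *)

theory Defs
  imports "HOL-Algebra.Ring" "HOL-Algebra.Coset"
begin

definition ring_center :: "('a, 'b) ring_scheme \<Rightarrow> 'a set"
  where "ring_center R =
    {c \<in> carrier R. \<forall>x \<in> carrier R. c \<otimes>\<^bsub>R\<^esub> x = x \<otimes>\<^bsub>R\<^esub> c}"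

definition nilpotents :: "('a, 'b) ring_scheme \<Rightarrow> 'a set"
  where "nilpotents R =
    {x \<in> carrier R. \<exists>k::nat. k > 0 \<and> x [^]\<^bsub>R\<^esub> k = \<zero>\<^bsub>R\<^esub>}"

definition idempotents :: "('a, 'b) ring_scheme \<Rightarrow> 'a set"
  where "idempotents R = {e \<in> carrier R. e \<otimes>\<^bsub>R\<^esub> e = e}"

text \<open>
  The locale \<^locale>\<open>ring\<close> requires neither commutativity nor \<open>\<one> \<noteq> \<zero>\<close>, so the zero
  ring is included throughout.
\<close>

locale CN_ring = ring +
  assumes CN: "a \<in> carrier R \<Longrightarrow> \<exists>c \<in> ring_center R. \<exists>n \<in> nilpotents R. a = c \<oplus> n"

text \<open>
  The left coset \<open>a <# carrier R\<close>, taken with respect to multiplication, is the principal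
  right ideal \<open>aR\<close>.
\<close>

locale exchange_ring = ring +
  assumes exchange: "a \<in> carrier R \<Longrightarrow>
    \<exists>e \<in> idempotents R. e \<in> a <# carrier R \<and> \<one> \<ominus> e \<in> (\<one> \<ominus> a) <# carrier R"

locale strongly_clean_ring = ring +
  assumes strongly_clean: "a \<in> carrier R \<Longrightarrow>
    \<exists>e \<in> idempotents R. \<exists>u \<in> Units R. a = e \<oplus> u \<and> e \<otimes> u = u \<otimes> e"

end

theory Submission
  imports Defs "HOL-Algebra.Multiplicative_Group"
begin

text \<open>
  Let \<open>e\<close> be an idempotent of a CN ring, \<open>e = c + n\<close>, and let \<open>y = e x (1 - e)\<close>. Then
  \<open>y n = - c y\<close> and \<open>n y = (1 - c) y\<close>, so that powers of both \<open>c\<close> and \<open>1 - c\<close> annihilate \<open>y\<close>,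
  which forces \<open>y = 0\<close>. Hence all idempotents of a CN ring are central. If moreover
  \<open>e = a r\<close> and \<open>1 - e = (1 - a) s\<close>, then \<open>r e - s (1 - e)\<close> is a right inverse of
  \<open>a - (1 - e)\<close>, and one-sided inverses are two-sided when idempotents are central.
\<close>

text \<open>After \<open>k\<close> factors have been exchanged, the next \<open>n\<close> stands to
  the right of \<open>d [^] k\<close>; commutation brings it back next to \<open>y\<close>, where it
  can be exchanged too.\<close>

lemma (in monoid) mult_pow_eq_mult_pow_central:
  assumes "y \<in> carrier G" "n \<in> carrier G" "d \<in> carrier G"
    and "y \<otimes> n = y \<otimes> d" and "d \<otimes> n = n \<otimes> d"
  shows "y \<otimes> n [^] (k::nat) = y \<otimes> d [^] k"
proof (induction k)
  case (Suc k)
  have "y \<otimes> n [^] Suc k = y \<otimes> d [^] k \<otimes> n"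
    using Suc assms by (simp add: m_assoc[symmetric])
  also have "\<dots> = y \<otimes> n \<otimes> d [^] k"
    using assms(1-3,5) by (simp add: m_assoc group_commutes_pow)
  also have "\<dots> = y \<otimes> (d \<otimes> d [^] k)"
    using assms(1-4) by (simp add: m_assoc)
  also have "\<dots> = y \<otimes> d [^] Suc k"
    using assms(3) by (simp only: nat_pow_Suc2)
  finally show ?case .
qed simp

text \<open>Here each \<open>n\<close> crosses \<open>y\<close> from the left and leaves a
  \<open>d\<close> behind, so \<open>d\<close> and \<open>n\<close> need not commute.\<close>

lemma (in monoid) pow_mult_eq_mult_pow:
  assumes "y \<in> carrier G" "n \<in> carrier G" "d \<in> carrier G"
    and "n \<otimes> y = y \<otimes> d"
  shows "n [^] (k::nat) \<otimes> y = y \<otimes> d [^] k"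
proof (induction k)
  case (Suc k)
  have "n [^] Suc k \<otimes> y = n [^] k \<otimes> y \<otimes> d"
    using assms by (simp add: m_assoc)
  then show ?case
    using Suc assms by (simp add: m_assoc)
qed (use assms in simp)

text \<open>The elements \<open>d\<close> and \<open>\<one> \<oplus> d\<close> are comaximal and
  commute. The induction strips one factor \<open>\<one> \<oplus> d\<close> at a time: if it kills
  \<open>z\<close>, then \<open>d\<close> acts on \<open>z\<close> as the unit -1, so a power of
  \<open>d\<close> can kill \<open>z\<close> only if \<open>z\<close> is zero.\<close>

lemma (in ring) eq_zero_if_mult_pows_eq_zero:
  assumes "y \<in> carrier R" "d \<in> carrier R"
    and d: "y \<otimes> d [^] (k::nat) = \<zero>" and "y \<otimes> (\<one> \<oplus> d) [^] (m::nat) = \<zero>"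
  shows "y = \<zero>"
  using assms(4)
proof (induction m)
  case (Suc m)
  define p where "p = (\<one> \<oplus> d) [^] m"
  define z where "z = y \<otimes> p"
  have p: "p \<in> carrier R" and z: "z \<in> carrier R"
    using assms by (simp_all add: p_def z_def)
  have "d \<otimes> (\<one> \<oplus> d) = (\<one> \<oplus> d) \<otimes> d"
    using assms by (simp add: r_distr l_distr)
  then have comm: "d \<otimes> p = p \<otimes> d"
    using assms by (simp add: p_def group_commutes_pow)
  have "z \<otimes> (\<one> \<oplus> d) = \<zero>"
    using Suc.prems assms by (simp add: z_def p_def m_assoc)
  then have "z \<oplus> z \<otimes> d = \<zero>"
    using z assms by (simp add: r_distr)
  then have "z \<otimes> d = z \<otimes> (\<ominus> \<one>)"
    using z assms by (simp add: r_minus minus_equality a_comm[of z])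
  then have "z \<otimes> d [^] k = z \<otimes> (\<ominus> \<one>) [^] k"
    using z assms by (intro mult_pow_eq_mult_pow_central) (auto simp: l_minus r_minus)
  \<comment> \<open>Moving \<open>p\<close> to the far right exposes
    \<open>y \<otimes> d [^] k\<close>, which is zero.\<close>
  moreover have "z \<otimes> d [^] k = y \<otimes> d [^] k \<otimes> p"
    using assms(1,2) p comm by (simp add: z_def m_assoc group_commutes_pow)
  ultimately have "z \<otimes> (\<ominus> \<one>) [^] k = \<zero>"
    using d p by simp
  moreover have "(\<ominus> \<one>) [^] k \<in> Units R"
    using Units_minus_one_closed by (rule Units_pow_closed)
  ultimately have "z = \<zero>"
    using z by (metis Units_closed Units_r_inv Units_inv_closed l_null m_assoc r_one)
  then show ?case
    using Suc.IH by (simp add: z_def p_def)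
qed (use assms in simp)

context CN_ring
begin

lemma idempotent_corner_zero:
  assumes e: "e \<in> idempotents R" and x: "x \<in> carrier R"
  shows "e \<otimes> x \<otimes> (\<one> \<ominus> e) = \<zero>"
proof -
  have ec: "e \<in> carrier R" and ee: "e \<otimes> e = e"
    using e by (auto simp: idempotents_def)
  obtain c n k where c: "c \<in> carrier R" and cent: "\<And>z. z \<in> carrier R \<Longrightarrow> c \<otimes> z = z \<otimes> c"
    and n: "n \<in> carrier R" and nk: "n [^] (k::nat) = \<zero>" and ecn: "e = c \<oplus> n"
    using CN[OF ec] by (auto simp: ring_center_def nilpotents_def)
  define y where "y = e \<otimes> x \<otimes> (\<one> \<ominus> e)"
  have y: "y \<in> carrier R"
    using ec x by (simp add: y_def)
  have "(\<one> \<ominus> e) \<otimes> e = \<zero>"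
    using ec ee by (simp add: minus_eq l_distr l_minus r_neg)
  then have "y \<otimes> e = \<zero>"
    using ec x by (simp add: y_def m_assoc)
  then have "y \<otimes> n \<oplus> y \<otimes> c = \<zero>"
    using y c n by (simp add: ecn r_distr a_comm)
  then have yn: "y \<otimes> n = y \<otimes> (\<ominus> c)"
    using y c n by (simp add: r_minus minus_equality)
  have "e \<otimes> y = y"
    using ec x ee by (simp add: y_def m_assoc[symmetric])
  then have "c \<otimes> y \<oplus> n \<otimes> y = y"
    using y c n by (simp add: ecn l_distr)
  then have "n \<otimes> y = y \<oplus> \<ominus> (c \<otimes> y)"
    using y c n by (metis a_comm a_minus_def add.inv_solve_right m_closed)
  then have ny: "n \<otimes> y = y \<otimes> (\<one> \<oplus> \<ominus> c)"
    using y c cent by (simp add: r_distr r_minus)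
  have "y \<otimes> (\<ominus> c) [^] k = y \<otimes> n [^] k"
    using y n c yn cent[OF n]
    by (intro mult_pow_eq_mult_pow_central[symmetric]) (auto simp: l_minus r_minus)
  moreover have "y \<otimes> (\<one> \<oplus> \<ominus> c) [^] k = n [^] k \<otimes> y"
    using y n c ny by (intro pow_mult_eq_mult_pow[symmetric]) auto
  \<comment> \<open>Since \<open>n [^] k\<close> vanishes, both products do. With
    \<open>\<ominus> c\<close> in the role of \<open>d\<close>, they are the two annihilation
    hypotheses, with the same exponent.\<close>
  ultimately have "y = \<zero>"
    using y c nk by (intro eq_zero_if_mult_pows_eq_zero[of y "\<ominus> c" k k]) auto
  then show ?thesis
    by (simp add: y_def)
qed

lemma idempotent_complement:
  assumes "e \<in> idempotents R"
  shows "\<one> \<ominus> e \<in> idempotents R"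
  using assms by (auto simp: idempotents_def minus_eq l_distr r_distr l_minus r_minus r_neg l_neg)

lemma idempotent_commutes:
  assumes e: "e \<in> idempotents R" and x: "x \<in> carrier R"
  shows "e \<otimes> x = x \<otimes> e"
proof -
  have ec: "e \<in> carrier R"
    using e by (auto simp: idempotents_def)
  \<comment> \<open>The corner lemma is applied to \<open>\<one> \<ominus> e\<close> as well as to
    \<open>e\<close>, so both off-diagonal Peirce corners vanish and both products equal
    \<open>e \<otimes> x \<otimes> e\<close>.\<close>
  have "\<one> \<ominus> (\<one> \<ominus> e) = e"
    using ec by (simp add: minus_eq minus_add r_neg2)
  then have "(\<one> \<ominus> e) \<otimes> x \<otimes> e = \<zero>"
    using idempotent_corner_zero[OF idempotent_complement[OF e] x] by simp
  then have "x \<otimes> e \<ominus> e \<otimes> x \<otimes> e = \<zero>"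
    using ec x by (simp add: minus_eq l_distr l_minus)
  then have xe: "x \<otimes> e = e \<otimes> x \<otimes> e"
    using ec x by simp
  have "e \<otimes> x \<ominus> e \<otimes> x \<otimes> e = \<zero>"
    using idempotent_corner_zero[OF e x] ec x by (simp add: minus_eq r_distr r_minus)
  then have "e \<otimes> x = e \<otimes> x \<otimes> e"
    using ec x by simp
  with xe show ?thesis
    by simp
qed

text \<open>The product \<open>v \<otimes> u\<close> is idempotent, hence central, and it fixes
  \<open>u\<close> from the right. So it also fixes \<open>u\<close> from the left, and cancelling
  \<open>u\<close> by means of \<open>v\<close> makes it one.\<close>

lemma right_invertible_imp_Unit:
  assumes u: "u \<in> carrier R" and v: "v \<in> carrier R" and uv: "u \<otimes> v = \<one>"
  shows "u \<in> Units R"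
proof -
  have "v \<otimes> u \<otimes> (v \<otimes> u) = v \<otimes> (u \<otimes> v) \<otimes> u"
    using u v by (simp add: m_assoc)
  then have "v \<otimes> u \<in> idempotents R"
    using u v uv by (simp add: idempotents_def)
  then have "v \<otimes> u \<otimes> u = u \<otimes> (v \<otimes> u)"
    using u by (rule idempotent_commutes)
  also have "\<dots> = u"
    using u v uv by (simp add: m_assoc[symmetric])
  finally have "v \<otimes> u \<otimes> u \<otimes> v = u \<otimes> v"
    by simp
  then have "v \<otimes> u = \<one>"
    using u v uv by (simp add: m_assoc)
  then show ?thesis
    using u v uv by (auto simp: Units_def)
qed

lemma exchange_imp_strongly_clean:
  assumes a: "a \<in> carrier R" and r: "r \<in> carrier R" and s: "s \<in> carrier R"
    and e: "a \<otimes> r \<in> idempotents R" and as: "\<one> \<ominus> a \<otimes> r = (\<one> \<ominus> a) \<otimes> s"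
  shows "\<exists>f \<in> idempotents R. \<exists>u \<in> Units R. a = f \<oplus> u \<and> f \<otimes> u = u \<otimes> f"
proof -
  define e where "e = a \<otimes> r"
  define f where "f = \<one> \<ominus> e"
  have f: "f \<in> idempotents R"
    unfolding f_def e_def using e by (rule idempotent_complement)
  have ec: "e \<in> carrier R" and ee: "e \<otimes> e = e" and fc: "f \<in> carrier R" and ff: "f \<otimes> f = f"
    using e f by (auto simp: idempotents_def e_def)
  have fe: "f \<otimes> e = \<zero>" and ef: "e \<oplus> f = \<one>"
    using ec ee by (simp_all add: f_def minus_eq l_distr l_minus r_neg a_lcomm[of e])
  \<comment> \<open>Centrality of \<open>f\<close> lets it pass \<open>r\<close> and
    \<open>s\<close>: it then meets \<open>e\<close> and gives zero, or meets \<open>f\<close> and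
    is absorbed.\<close>
  have frs: "f \<otimes> (r \<otimes> e) = \<zero>" "f \<otimes> (s \<otimes> f) = s \<otimes> f"
    using idempotent_commutes[OF f] r s ec fc fe ff
    by (metis m_assoc r_null, metis m_assoc)
  define u where "u = a \<ominus> f"
  define v where "v = r \<otimes> e \<ominus> s \<otimes> f"
  have u: "u \<in> carrier R" and v: "v \<in> carrier R"
    using a r s ec fc by (simp_all add: u_def v_def)
  have are: "a \<otimes> (r \<otimes> e) = e"
    using a r ec ee by (simp add: m_assoc[symmetric] e_def[symmetric])
  have "f \<otimes> f = (\<one> \<ominus> a) \<otimes> s \<otimes> f"
    using as by (simp add: f_def e_def)
  then have asf: "f = s \<otimes> f \<ominus> a \<otimes> (s \<otimes> f)"
    using a s fc ff by (simp add: minus_eq l_distr l_minus m_assoc)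
  \<comment> \<open>The four terms are grouped so that the first difference is \<open>e\<close> and
    the second is \<open>(\<one> \<ominus> a) \<otimes> s \<otimes> f\<close>, that is,
    \<open>f\<close>.\<close>
  have "u \<otimes> v = a \<otimes> (r \<otimes> e) \<ominus> f \<otimes> (r \<otimes> e) \<oplus> (f \<otimes> (s \<otimes> f) \<ominus> a \<otimes> (s \<otimes> f))"
    using a r s ec fc
    by (simp add: u_def v_def minus_eq l_distr r_distr l_minus r_minus minus_add a_ac)
  also have "\<dots> = e \<oplus> f"
    using are frs asf[symmetric] ec by (simp add: minus_eq)
  finally have "u \<in> Units R"
    using u v ef by (simp add: right_invertible_imp_Unit)
  moreover have "a = f \<oplus> u"
    using a fc by (simp add: u_def minus_eq a_lcomm[of f] r_neg)
  moreover have "f \<otimes> u = u \<otimes> f"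
    using f u by (rule idempotent_commutes)
  ultimately show ?thesis
    using f by blast
qed

end

theorem corollary2p26:
  fixes R :: "('a, 'b) ring_scheme"
  assumes "exchange_ring R" and "CN_ring R"
  shows "strongly_clean_ring R"
proof -
  interpret exchange_ring R by fact
  interpret CN_ring R by fact
  show ?thesis
    by unfold_locales
      (use exchange exchange_imp_strongly_clean in \<open>fastforce simp: l_coset_def\<close>)
qed

end
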